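(* Let $\beta\in(0,1)$, $\tau\in\mathbb{R}$, and let the perturbations $\zeta_1,\dots,\zeta_n$ be independent normal random variables, $\zeta_j$ having mean $m_j$ and standard deviation $s_j>0$. Consider the chance constrained portfolio optimization problem $$\min_{x\in\mathbb{R}^n}\ \frac12\sum_{i=1}^n\sum_{j=1}^n\sigma_{ij}x_ix_j\quad\text{s.t.}\quad \mathrm{Prob}_{\zeta}\Big\{\sum_{j=1}^n\mu_j^{(0)}x_j+\sum_{j=1}^n\mu_j^{(j)}x_j\zeta_j\ \ge\ \tau\Big\}\ge\beta,\quad \sum_{i=1}^n x_i=1,\quad x_i\ge 0\ (i=1,\dots,n).$$ Then the deterministic form of the robust counterpart of this problem is given by a second order conic programming (SOCP) problem, namely $$\min_{x\in\mathbb{R}^n}\ \frac12\sum_{i=1}^n\sum_{j=1}^n\sigma_{ij}x_ix_j$$ $$\text{s.t.}\quad \sum_{j=1}^n\mu_j^{(0)}x_j+\sum_{j=1}^n\mu_j^{(j)}x_jm_j+\sqrt2\,\operatorname{erf}^{-1}(1-2\beta)\sqrt{\sum_{j=1}^n\big(s_j\mu_j^{(j)}x_j\big)^2}\ \ge\ \tau,\quad \sum_{i=1}^n x_i=1,\quad x_i\ge0\ (i=1,\dots,n).$$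
   Context: There are $n$ assets; $\Sigma=(\sigma_{ij})\in\mathbb{R}^{n\times n}$ is the (known) covariance matrix of the asset returns, and $x=(x_1,\dots,x_n)^\top$ is the vector of portfolio weights. The expected return vector is uncertain and affinely parameterized by the random perturbation vector $\zeta=(\zeta_1,\dots,\zeta_n)^\top$: $\mu(\zeta)=\mu^{(0)}+\sum_{j=1}^n\zeta_j\mu^{(j)}$, where $\mu^{(0)}=(\mu_1^{(0)},\dots,\mu_n^{(0)})^\top\in\mathbb{R}^n$ is the nominal vector and the basic shift $\mu^{(j)}\in\mathbb{R}^n$ has $j$-th entry $\mu_j^{(j)}$ and all other entries $0$. Hence $\mu(\zeta)^\top x=\sum_j\mu_j^{(0)}x_j+\sum_j\mu_j^{(j)}x_j\zeta_j$. The number $\tau$ is the target portfolio return and $\beta$ is the level of confidence. Since the objective is free of uncertainty, the deterministic form of the robust counterpart means the problem with the same objective in which the chance constraint is rewritten as a deterministic constraint on $x$. An SOCP (second order conic programming) problem is one whose constraints are linear or second-order cone constraints, i.e. of the form $\|Ax+b\|_2\le c^\top x+d$ (a convex quadratic objective being allowed). $\operatorname{erf}(t)=\frac{2}{\sqrt\pi}\int_0^t e^{-u^2}\,du$ is the Gauss error function and $\operatorname{erf}^{-1}:(-1,1)\to\mathbb{R}$ is its inverse.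
   Formalization: The equivalence of the two problems is proved for all β in (0,1), but the deterministic problem is claimed to be an SOCP only for β ≥ 1/2; for β < 1/2 the coefficient erf⁻¹(1−2β) is positive and the feasible set can be non-convex, so the SOCP claim fails. *)

theory Defs
  imports "HOL-Probability.Probability"
begin

definition erf :: "real \<Rightarrow> real" where
  "erf t = 2 / sqrt pi * (LBINT u=0..t. exp (- u\<^sup>2))"

text \<open>Only meaningful on the open interval from -1 to 1, which is the range of \<^const>\<open>erf\<close>.\<close>

definition erf_inv :: "real \<Rightarrow> real" where
  "erf_inv = inv erf"

definition covariance :: "'a measure \<Rightarrow> ('a \<Rightarrow> real) \<Rightarrow> ('a \<Rightarrow> real) \<Rightarrow> real" where
  "covariance N X Y = (LINT \<omega>|N. (X \<omega> - (LINT \<omega>'|N. X \<omega>')) * (Y \<omega> - (LINT \<omega>'|N. Y \<omega>')))"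

text \<open>The vector \<open>\<mu> j\<close> is the \<open>j\<close>-th basic shift.\<close>

definition expected_return :: "real^'n \<Rightarrow> ('n \<Rightarrow> real^'n) \<Rightarrow> ('n \<Rightarrow> real) \<Rightarrow> real^'n" where
  "expected_return \<mu>0 \<mu> z = \<mu>0 + (\<Sum>j\<in>UNIV. z j *\<^sub>R \<mu> j)"

lemma expected_return_inner:
  assumes "\<And>i j. i \<noteq> j \<Longrightarrow> \<mu> j $ i = 0"
  shows "expected_return \<mu>0 \<mu> z \<bullet> x
    = (\<Sum>j\<in>UNIV. \<mu>0 $ j * x $ j) + (\<Sum>j\<in>UNIV. \<mu> j $ j * x $ j * z j)"
proof -
  have "\<mu> j \<bullet> x = \<mu> j $ j * x $ j" for j
  proof -
    have "\<mu> j \<bullet> x = (\<Sum>i\<in>UNIV. if i = j then \<mu> j $ j * x $ j else 0)"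
      unfolding inner_vec_def by (rule sum.cong) (auto simp: assms)
    then show ?thesis by simp
  qed
  then have "(\<Sum>j\<in>UNIV. z j *\<^sub>R \<mu> j) \<bullet> x = (\<Sum>j\<in>UNIV. \<mu> j $ j * x $ j * z j)"
    by (simp add: inner_sum_left mult_ac)
  then show ?thesis
    by (simp add: expected_return_def inner_add_left) (simp add: inner_vec_def)
qed

text \<open>A minimization problem. Constraints are predicates, so that the definitions of linear and
  second-order cone constraints below do not depend on how a constraint is written.\<close>

record 'a opt_problem =
  objective :: "'a \<Rightarrow> real"
  constraints :: "('a \<Rightarrow> bool) set"

definition feasible :: "'a opt_problem \<Rightarrow> 'a set" where
  "feasible P = {x. \<forall>C\<in>constraints P. C x}"

definition minimizers :: "'a opt_problem \<Rightarrow> 'a set" where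
  "minimizers P = {x \<in> feasible P. \<forall>y\<in>feasible P. objective P x \<le> objective P y}"

definition convex_quadratic :: "(real^'n \<Rightarrow> real) \<Rightarrow> bool" where
  "convex_quadratic f \<longleftrightarrow> convex_on UNIV f \<and>
     (\<exists>(Q::real^'n^'n) q r. \<forall>x. f x = x \<bullet> (Q *v x) + q \<bullet> x + r)"

definition linear_constraint :: "(real^'n \<Rightarrow> bool) \<Rightarrow> bool" where
  "linear_constraint C \<longleftrightarrow>
     (\<exists>a b. \<forall>x. C x \<longleftrightarrow> a \<bullet> x \<le> b) \<or> (\<exists>a b. \<forall>x. C x \<longleftrightarrow> a \<bullet> x = b)"

text \<open>The matrix has an arbitrary number \<open>m\<close> of rows, the \<open>k\<close>-th one being \<open>A k\<close>.\<close>

definition soc_constraint :: "(real^'n \<Rightarrow> bool) \<Rightarrow> bool" where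
  "soc_constraint C \<longleftrightarrow>
     (\<exists>(m::nat) (A::nat \<Rightarrow> real^'n) (b::nat \<Rightarrow> real) c d.
        \<forall>x. C x \<longleftrightarrow> L2_set (\<lambda>k. A k \<bullet> x + b k) {..<m} \<le> c \<bullet> x + d)"

definition is_SOCP :: "(real^'n) opt_problem \<Rightarrow> bool" where
  "is_SOCP P \<longleftrightarrow> convex_quadratic (objective P) \<and> finite (constraints P) \<and>
     (\<forall>C\<in>constraints P. linear_constraint C \<or> soc_constraint C)"

definition portfolio_problem ::
  "real^'n^'n \<Rightarrow> (real^'n \<Rightarrow> bool) \<Rightarrow> (real^'n) opt_problem" where
  "portfolio_problem \<Sigma> C =
     \<lparr> objective = (\<lambda>x. 1/2 * (\<Sum>i\<in>UNIV. \<Sum>j\<in>UNIV. \<Sigma> $ i $ j * x $ i * x $ j)),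
       constraints = {C, \<lambda>x. (\<Sum>i\<in>UNIV. x $ i) = 1} \<union> range (\<lambda>i x. 0 \<le> x $ i) \<rparr>"

definition chance_constraint ::
  "'a measure \<Rightarrow> ('n \<Rightarrow> 'a \<Rightarrow> real) \<Rightarrow> real^'n \<Rightarrow> ('n \<Rightarrow> real^'n) \<Rightarrow> real \<Rightarrow> real
    \<Rightarrow> real^'n \<Rightarrow> bool" where
  "chance_constraint M \<zeta> \<mu>0 \<mu> \<tau> \<beta> x \<longleftrightarrow>
     \<P>(\<omega> in M. (\<Sum>j\<in>UNIV. \<mu>0 $ j * x $ j) + (\<Sum>j\<in>UNIV. \<mu> j $ j * x $ j * \<zeta> j \<omega>) \<ge> \<tau>) \<ge> \<beta>"

definition deterministic_constraint ::
  "real^'n \<Rightarrow> real^'n \<Rightarrow> real^'n \<Rightarrow> ('n \<Rightarrow> real^'n) \<Rightarrow> real \<Rightarrow> real \<Rightarrow> real^'n \<Rightarrow> bool" where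
  "deterministic_constraint m s \<mu>0 \<mu> \<tau> \<beta> x \<longleftrightarrow>
     (\<Sum>j\<in>UNIV. \<mu>0 $ j * x $ j) + (\<Sum>j\<in>UNIV. \<mu> j $ j * x $ j * m $ j)
       + sqrt 2 * erf_inv (1 - 2 * \<beta>) * sqrt (\<Sum>j\<in>UNIV. (s $ j * \<mu> j $ j * x $ j)\<^sup>2) \<ge> \<tau>"

end

theory Submission
  imports Defs
begin

text \<open>For fixed weights the random part of the portfolio return is a linear combination of
  independent normal variables, hence normal with the mean and standard deviation that appear in the
  deterministic constraint. Its upper tail is \<open>(1 - erf w) / 2\<close> with \<open>w\<close> the standardized threshold
  divided by the square root of 2, so the chance constraint says \<open>erf w \<le> 1 - 2 \<beta>\<close>. If all its
  coefficients vanish the random part is degenerate, and both constraints reduce to the same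
  inequality because \<open>0 < \<beta> < 1\<close>. For \<open>\<beta> \<ge> 1/2\<close> the factor \<open>erf_inv (1 - 2 \<beta>)\<close> is nonpositive, which
  is the sign that makes the constraint a second-order cone constraint.\<close>

section \<open>The error function\<close>

lemma erf_has_real_derivative:
  "(erf has_real_derivative 2 / sqrt pi * exp (- t\<^sup>2)) (at t)"
proof -
  \<comment> \<open>The interval has to contain both 0, the base point of the integral, and
    \<open>t\<close>. The margin 1 puts \<open>t\<close> in its interior, where a derivative within
    the interval is a full one.\<close>
  define a b where "a = min 0 t - 1" and "b = max 0 t + 1"
  have "((\<lambda>u. LBINT y=(0::real)..u. exp (- y\<^sup>2)) has_vector_derivative exp (- t\<^sup>2)) (at t within {a..b})"
    by (rule interval_integral_FTC2) (auto simp: a_def b_def intro!: continuous_intros)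
  then have "((\<lambda>u. LBINT y=0..u. exp (- y\<^sup>2)) has_real_derivative exp (- t\<^sup>2)) (at t)"
    by (subst (asm) at_within_interior)
       (auto simp: a_def b_def zero_ereal_def has_real_derivative_iff_has_vector_derivative)
  then show ?thesis
    unfolding erf_def[abs_def] by (rule DERIV_cmult)
qed

lemma continuous_on_erf: "continuous_on A erf"
  by (rule DERIV_continuous_on) (rule has_field_derivative_at_within[OF erf_has_real_derivative])

lemma strict_mono_erf: "strict_mono erf"
proof (rule strict_monoI)
  fix x y :: real assume "x < y"
  then show "erf x < erf y"
    by (rule DERIV_pos_imp_increasing) (auto intro!: exI erf_has_real_derivative)
qed

lemma erf_0 [simp]: "erf 0 = 0"
  by (simp add: erf_def zero_ereal_def)

lemma erf_minus: "erf (- t) = - erf t"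
proof -
  have "(LBINT u=0..-t. exp (- u\<^sup>2)) = (LBINT u=t..0. exp (- u\<^sup>2))"
    by (subst interval_integral_reflect) simp
  also have "\<dots> = - (LBINT u=0..t. exp (- u\<^sup>2))"
    by (rule interval_integral_endpoints_reverse)
  finally show ?thesis
    by (simp add: erf_def)
qed

section \<open>Gaussian integrals and the range of \<open>erf\<close>\<close>

lemma integrable_gaussian: "integrable lborel (\<lambda>u::real. exp (- u\<^sup>2))"
proof -
  \<comment> \<open>The integrand is \<open>sqrt pi\<close> times the normal density of variance
    1/2.\<close>
  have "integrable lborel (\<lambda>u. sqrt pi * normal_density 0 (1 / sqrt 2) u)"
    by simp
  then show ?thesis
    by (simp add: normal_density_def power_divide)
qed

lemma set_integrable_gaussian: "A \<in> sets lborel \<Longrightarrow> set_integrable lborel A (\<lambda>u::real. exp (- u\<^sup>2))"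
  unfolding set_integrable_def using integrable_gaussian
  by (rule integrable_mult_indicator[rotated])

lemma gaussian_half_line: "(LBINT u:{0..}. exp (- u\<^sup>2)) = sqrt pi / 2"
  unfolding set_lebesgue_integral_def by (rule has_bochner_integral_integral_eq[OF gaussian_moment_0])

text \<open>The half-line integral from 0 is split at \<open>w\<close>. Interval integrals are
  oriented, so negative \<open>w\<close> needs no separate case.\<close>

lemma gaussian_tail: "(LBINT u:{w..}. exp (- u\<^sup>2)) = sqrt pi / 2 * (1 - erf w)"
proof -
  \<comment> \<open>An interval integral up to infinity runs over the open half-line; the endpoint
    is a null set.\<close>
  have half_open: "(LBINT u:{w<..}. exp (- u\<^sup>2)) = (LBINT u:{w..}. exp (- u\<^sup>2))" for w :: real
    by (rule set_integral_discrete_difference[where X = "{w}"]) auto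
  have "(LBINT u=0..w. exp (- u\<^sup>2)) + (LBINT u=w..\<infinity>. exp (- u\<^sup>2)) = (LBINT u=0..\<infinity>. exp (- u\<^sup>2))"
    by (rule interval_integral_sum)
       (auto simp: interval_lebesgue_integrable_def intro!: set_integrable_gaussian)
  then have "(LBINT u=0..w. exp (- u\<^sup>2)) + (LBINT u:{w..}. exp (- u\<^sup>2)) = sqrt pi / 2"
    by (simp add: zero_ereal_def interval_integral_to_infinity_eq half_open gaussian_half_line)
  then show ?thesis
    by (simp add: erf_def right_diff_distrib)
qed

lemma erf_tendsto_1: "(erf \<longlongrightarrow> 1) at_top"
proof (rule Lim_transform_eventually)
  have "((\<lambda>t. 2 / sqrt pi * (LBINT u:{0..t}. exp (- u\<^sup>2))) \<longlongrightarrow>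
      2 / sqrt pi * (LBINT u:{0..}. exp (- u\<^sup>2))) at_top"
    by (intro tendsto_intros tendsto_set_lebesgue_integral_at_top set_integrable_gaussian) auto
  then show "((\<lambda>t. 2 / sqrt pi * (LBINT u:{0..t}. exp (- u\<^sup>2))) \<longlongrightarrow> 1) at_top"
    unfolding gaussian_half_line by simp
  show "\<forall>\<^sub>F t in at_top. 2 / sqrt pi * (LBINT u:{0..t}. exp (- u\<^sup>2)) = erf t"
    using eventually_ge_at_top[of 0]
    by eventually_elim (simp add: erf_def zero_ereal_def interval_integral_Icc)
qed

text \<open>\<open>inv erf\<close> is a right inverse only on the range of \<open>erf\<close>. The
  limit 1 at infinity gives some \<open>t\<close> with \<open>erf t\<close> above \<bar>y\<bar>,
  oddness bounds \<open>y\<close> from below by \<open>erf (- t)\<close>, and the intermediate value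
  theorem does the rest.\<close>

lemma erf_erf_inv:
  assumes "\<bar>y\<bar> < 1"
  shows "erf (erf_inv y) = y"
proof -
  have "\<forall>\<^sub>F t in at_top. \<bar>y\<bar> < erf t \<and> 0 \<le> t"
    using order_tendstoD(1)[OF erf_tendsto_1 assms] eventually_ge_at_top by (rule eventually_conj)
  then obtain t where t: "\<bar>y\<bar> < erf t" "0 \<le> t"
    by (auto simp: eventually_at_top_linorder)
  then have "\<exists>x. - t \<le> x \<and> x \<le> t \<and> erf x = y"
    by (intro IVT' continuous_on_erf) (auto simp: erf_minus)
  then have "y \<in> range erf"
    by auto
  then show ?thesis
    unfolding erf_inv_def by (rule f_inv_into_f)
qed

lemma erf_le_iff: "\<bar>y\<bar> < 1 \<Longrightarrow> erf w \<le> y \<longleftrightarrow> w \<le> erf_inv y"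
  by (metis erf_erf_inv strict_mono_erf strict_mono_less_eq)

lemma erf_inv_nonpos:
  assumes "- 1 < y" "y \<le> 0"
  shows "erf_inv y \<le> 0"
  using assms erf_erf_inv[of y] strict_mono_less_eq[OF strict_mono_erf, of "erf_inv y" 0] by simp

section \<open>The chance constraint for normal perturbations\<close>

context prob_space
begin

lemma prob_normal_ge:
  assumes X: "distributed M lborel X (normal_density \<mu> \<sigma>)" and \<sigma>: "0 < \<sigma>"
  shows "\<P>(\<omega> in M. t \<le> X \<omega>) = (1 - erf ((t - \<mu>) / (sqrt 2 * \<sigma>))) / 2"
proof -
  define w where "w = (t - \<mu>) / (sqrt 2 * \<sigma>)"
  \<comment> \<open>Rescaling to mean 0 and standard deviation \<open>1 / sqrt 2\<close>, rather
    than 1, makes the density exactly \<open>exp (- u\<^sup>2) / sqrt pi\<close>, the integrand of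
    \<open>gaussian_tail\<close>.\<close>
  define W where "W = (\<lambda>\<omega>. - \<mu> / (sqrt 2 * \<sigma>) + 1 / (sqrt 2 * \<sigma>) * X \<omega>)"
  have "distributed M lborel W (normal_density 0 (1 / sqrt 2))"
    using normal_density_affine[OF X \<sigma>, of "1 / (sqrt 2 * \<sigma>)" "- \<mu> / (sqrt 2 * \<sigma>)"] \<sigma>
    by (simp add: W_def abs_mult)
  then have "expectation (\<lambda>\<omega>. indicator {w..} (W \<omega>))
      = (LBINT u. normal_density 0 (1 / sqrt 2) u * indicator {w..} u)"
    by (subst distributed_integral[symmetric]) auto
  also have "\<dots> = (LBINT u:{w..}. exp (- u\<^sup>2)) / sqrt pi"
    unfolding set_lebesgue_integral_def integral_divide_zero[symmetric]
    by (rule Bochner_Integration.integral_cong) (auto simp: normal_density_def power_divide)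
  also have "\<dots> = (1 - erf w) / 2"
    by (simp add: gaussian_tail)
  also have "expectation (\<lambda>\<omega>. indicator {w..} (W \<omega>)) = expectation (indicator {\<omega> \<in> space M. t \<le> X \<omega>})"
    by (rule Bochner_Integration.integral_cong)
       (use \<sigma> in \<open>auto simp: w_def W_def field_simps split: split_indicator\<close>)
  also have "\<dots> = \<P>(\<omega> in M. t \<le> X \<omega>)"
    by (simp add: Int_absorb2)
  finally show ?thesis
    by (simp add: w_def)
qed

lemma normal_chance_constraint_iff:
  assumes X: "distributed M lborel X (normal_density \<mu> \<sigma>)" and \<sigma>: "0 < \<sigma>"
    and \<beta>: "0 < \<beta>" "\<beta> < 1"
  shows "\<beta> \<le> \<P>(\<omega> in M. t \<le> X \<omega>) \<longleftrightarrow> t \<le> \<mu> + sqrt 2 * erf_inv (1 - 2 * \<beta>) * \<sigma>"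
proof -
  have "\<beta> \<le> \<P>(\<omega> in M. t \<le> X \<omega>) \<longleftrightarrow> erf ((t - \<mu>) / (sqrt 2 * \<sigma>)) \<le> 1 - 2 * \<beta>"
    unfolding prob_normal_ge[OF X \<sigma>] by auto
  \<comment> \<open>Since \<open>0 < \<beta> < 1\<close>, the argument
    \<open>1 - 2 * \<beta>\<close> lies strictly between -1 and 1, where \<open>erf\<close> can be
    inverted.\<close>
  also have "\<dots> \<longleftrightarrow> (t - \<mu>) / (sqrt 2 * \<sigma>) \<le> erf_inv (1 - 2 * \<beta>)"
    using \<beta> by (intro erf_le_iff) auto
  also have "\<dots> \<longleftrightarrow> t \<le> \<mu> + sqrt 2 * erf_inv (1 - 2 * \<beta>) * \<sigma>"
    using \<sigma> by (simp add: pos_divide_le_eq algebra_simps)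
  finally show ?thesis .
qed

text \<open>The sum rule for independent normals asks for positive standard deviations and a
  nonempty index set. Terms with zero coefficient are therefore dropped; they contribute nothing to
  the sum, the mean or the variance.\<close>

lemma normal_linear_combination:
  fixes \<zeta> :: "'i::finite \<Rightarrow> 'a \<Rightarrow> real"
  assumes indep: "indep_vars (\<lambda>_. borel) \<zeta> UNIV"
    and s: "\<And>j. 0 < s j"
    and \<zeta>: "\<And>j. distributed M lborel (\<zeta> j) (normal_density (m j) (s j))"
    and c: "\<exists>j. c j \<noteq> 0"
  shows "distributed M lborel (\<lambda>\<omega>. \<Sum>j\<in>UNIV. c j * \<zeta> j \<omega>)
    (normal_density (\<Sum>j\<in>UNIV. c j * m j) (sqrt (\<Sum>j\<in>UNIV. (s j * c j)\<^sup>2)))"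
proof -
  define J where "J = {j. c j \<noteq> 0}"
  have restrict: "(\<Sum>j\<in>UNIV. f j) = (\<Sum>j\<in>J. f j)" if "\<And>j. c j = 0 \<Longrightarrow> f j = 0" for f :: "'i \<Rightarrow> real"
    by (rule sum.mono_neutral_right) (auto simp: J_def that)
  have "distributed M lborel (\<lambda>\<omega>. \<Sum>j\<in>J. c j * \<zeta> j \<omega>)
    (normal_density (\<Sum>j\<in>J. c j * m j) (sqrt (\<Sum>j\<in>J. (\<bar>c j\<bar> * s j)\<^sup>2)))"
  proof (rule sum_indep_normal)
    show "finite J" "J \<noteq> {}"
      using c by (auto simp: J_def)
    show "indep_vars (\<lambda>_. borel) (\<lambda>j \<omega>. c j * \<zeta> j \<omega>) J"
      by (rule indep_vars_compose2[OF indep_vars_subset[OF indep]]) auto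
    show "0 < \<bar>c j\<bar> * s j" if "j \<in> J" for j
      using that s by (simp add: J_def)
    show "distributed M lborel (\<lambda>\<omega>. c j * \<zeta> j \<omega>) (normal_density (c j * m j) (\<bar>c j\<bar> * s j))"
      if "j \<in> J" for j
      using normal_density_affine[OF \<zeta>[of j] s[of j], of "c j" 0] that by (simp add: J_def)
  qed
  then show ?thesis
    by (simp add: restrict power_mult_distrib mult.commute)
qed

lemma chance_constraint_iff_deterministic_constraint:
  fixes \<zeta> :: "'i::finite \<Rightarrow> 'a \<Rightarrow> real"
  assumes indep: "indep_vars (\<lambda>_. borel) \<zeta> UNIV"
    and s: "\<And>j. 0 < s $ j"
    and \<zeta>: "\<And>j. distributed M lborel (\<zeta> j) (normal_density (m $ j) (s $ j))"
    and \<beta>: "0 < \<beta>" "\<beta> < 1"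
  shows "chance_constraint M \<zeta> \<mu>0 \<mu> \<tau> \<beta> x \<longleftrightarrow> deterministic_constraint m s \<mu>0 \<mu> \<tau> \<beta> x"
proof -
  define c where "c j = \<mu> j $ j * x $ j" for j
  define a where "a = (\<Sum>j\<in>UNIV. \<mu>0 $ j * x $ j)"
  have chance: "chance_constraint M \<zeta> \<mu>0 \<mu> \<tau> \<beta> x \<longleftrightarrow>
      \<beta> \<le> \<P>(\<omega> in M. \<tau> - a \<le> (\<Sum>j\<in>UNIV. c j * \<zeta> j \<omega>))"
    by (simp add: chance_constraint_def c_def a_def algebra_simps)
  have det: "deterministic_constraint m s \<mu>0 \<mu> \<tau> \<beta> x \<longleftrightarrow>
      \<tau> - a \<le> (\<Sum>j\<in>UNIV. c j * m $ j)
        + sqrt 2 * erf_inv (1 - 2 * \<beta>) * sqrt (\<Sum>j\<in>UNIV. (s $ j * c j)\<^sup>2)"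
    by (simp add: deterministic_constraint_def c_def a_def algebra_simps)
  show ?thesis
  proof (cases "\<exists>j. c j \<noteq> 0")
    case True
    then obtain i where "c i \<noteq> 0" ..
    then have "0 < (\<Sum>j\<in>UNIV. (s $ j * c j)\<^sup>2)"
      by (intro sum_pos2[of _ i]) (use s[of i] in auto)
    then show ?thesis
      unfolding chance det
      by (intro normal_chance_constraint_iff normal_linear_combination indep s \<zeta> \<beta> True) auto
  next
    case False
    then show ?thesis
      \<comment> \<open>The random part is zero, so the probability is 1 if
        \<open>\<tau> \<le> a\<close> and 0 otherwise.\<close>
      unfolding chance det using \<beta> by (cases "\<tau> \<le> a") (auto simp: prob_space)
  qed
qed

end

section \<open>The deterministic problem is a second-order cone problem\<close>

text \<open>Allows rows indexed by any finite type; a bijection with an initial segment of the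
  naturals renumbers them.\<close>

lemma soc_constraintI:
  fixes A :: "'i::finite \<Rightarrow> real^'n"
  assumes "\<And>x. C x \<longleftrightarrow> L2_set (\<lambda>i. A i \<bullet> x + b i) UNIV \<le> c \<bullet> x + d"
  shows "soc_constraint C"
proof -
  obtain h :: "nat \<Rightarrow> 'i" where h: "bij_betw h {..<CARD('i)} UNIV"
    using ex_bij_betw_nat_finite[of "UNIV :: 'i set"] by (auto simp: atLeast0LessThan)
  have "L2_set f UNIV = L2_set (\<lambda>k. f (h k)) {..<CARD('i)}" for f
    unfolding L2_set_def by (simp add: sum.reindex_bij_betw[OF h, of "\<lambda>i. (f i)\<^sup>2"])
  then show ?thesis
    unfolding soc_constraint_def
    by (intro exI[of _ "CARD('i)"] exI[of _ "\<lambda>k. A (h k)"] exI[of _ "\<lambda>k. b (h k)"]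
        exI[of _ c] exI[of _ d]) (simp add: assms)
qed

lemma soc_constraint_deterministic_constraint:
  fixes m s \<mu>0 :: "real^'n"
  assumes "1/2 \<le> \<beta>" "\<beta> < 1"
  shows "soc_constraint (deterministic_constraint m s \<mu>0 \<mu> \<tau> \<beta>)"
proof -
  \<comment> \<open>Minus the coefficient of the square root. As \<open>K\<close> is nonnegative, it
    can be moved inside the norm, on the smaller side of the inequality.\<close>
  define K where "K = - (sqrt 2 * erf_inv (1 - 2 * \<beta>))"
  have K: "0 \<le> K"
    using erf_inv_nonpos[of "1 - 2 * \<beta>"] assms by (simp add: K_def mult_nonneg_nonpos)
  define A where "A j = axis j (K * (s $ j * \<mu> j $ j))" for j
  define c where "c = (\<chi> j. \<mu>0 $ j + \<mu> j $ j * m $ j)"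
  show ?thesis
  proof (rule soc_constraintI)
    fix x
    have "L2_set (\<lambda>j. A j \<bullet> x + 0) UNIV = L2_set (\<lambda>j. K * (s $ j * \<mu> j $ j * x $ j)) UNIV"
      by (simp add: A_def inner_axis' mult_ac)
    also have "\<dots> = K * L2_set (\<lambda>j. s $ j * \<mu> j $ j * x $ j) UNIV"
      using K by (rule L2_set_right_distrib[symmetric])
    finally have "L2_set (\<lambda>j. A j \<bullet> x + 0) UNIV = K * sqrt (\<Sum>j\<in>UNIV. (s $ j * \<mu> j $ j * x $ j)\<^sup>2)"
      by (simp add: L2_set_def)
    moreover have "c \<bullet> x = (\<Sum>j\<in>UNIV. \<mu>0 $ j * x $ j) + (\<Sum>j\<in>UNIV. \<mu> j $ j * x $ j * m $ j)"
      by (simp add: c_def inner_vec_def algebra_simps sum.distrib)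
    ultimately show "deterministic_constraint m s \<mu>0 \<mu> \<tau> \<beta> x \<longleftrightarrow>
        L2_set (\<lambda>j. A j \<bullet> x + 0) UNIV \<le> c \<bullet> x + - \<tau>"
      by (auto simp: deterministic_constraint_def K_def)
  qed
qed

section \<open>Convexity of the objective and the SOCP form\<close>

lemma convex_quadraticI:
  fixes A :: "real^'n^'n"
  assumes psd: "\<And>x. 0 \<le> x \<bullet> (A *v x)"
  shows "convex_quadratic (\<lambda>x. x \<bullet> (A *v x))"
proof -
  have "convex_on UNIV (\<lambda>x. x \<bullet> (A *v x))"
  proof (rule convex_onI)
    fix t :: real and x y :: "real^'n"
    assume t: "0 < t" "t < 1"
    \<comment> \<open>The convexity gap of a quadratic form is \<open>t * (1 - t)\<close> times its
      value at \<open>x - y\<close>.\<close>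
    have "(1 - t) * (x \<bullet> (A *v x)) + t * (y \<bullet> (A *v y))
        - ((1 - t) *\<^sub>R x + t *\<^sub>R y) \<bullet> (A *v ((1 - t) *\<^sub>R x + t *\<^sub>R y))
      = t * (1 - t) * ((x - y) \<bullet> (A *v (x - y)))"
      by (simp add: matrix_vector_right_distrib matrix_vector_mult_diff_distrib matrix_vector_mult_scaleR
          inner_add_left inner_add_right inner_diff_left inner_diff_right) algebra
    also have "\<dots> \<ge> 0"
      using t psd by simp
    finally show "((1 - t) *\<^sub>R x + t *\<^sub>R y) \<bullet> (A *v ((1 - t) *\<^sub>R x + t *\<^sub>R y))
        \<le> (1 - t) * (x \<bullet> (A *v x)) + t * (y \<bullet> (A *v y))"
      by simp
  qed simp
  then show ?thesis
    unfolding convex_quadratic_def by (intro conjI exI[of _ A] exI[of _ 0]) auto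
qed

lemma inner_matrix_vector_mult:
  fixes A :: "real^'n^'n"
  shows "x \<bullet> (A *v x) = (\<Sum>i\<in>UNIV. \<Sum>j\<in>UNIV. A $ i $ j * x $ i * x $ j)"
  by (simp add: inner_vec_def matrix_vector_mult_def sum_distrib_left mult_ac)

text \<open>The form is the variance of the weighted return: the expectation of the square of the
  weighted sum of centered returns.\<close>

lemma covariance_quadratic_form_nonneg:
  fixes R :: "'n::finite \<Rightarrow> 'b \<Rightarrow> real"
  assumes "prob_space N" and R: "\<And>i. R i \<in> borel_measurable N"
    and R2: "\<And>i. integrable N (\<lambda>\<omega>. (R i \<omega>)\<^sup>2)"
  shows "0 \<le> (\<Sum>i\<in>UNIV. \<Sum>j\<in>UNIV. covariance N (R i) (R j) * x i * x j)"
proof -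
  interpret prob_space N by fact
  define D where "D i \<omega> = R i \<omega> - expectation (R i)" for i \<omega>
  have D: "D i \<in> borel_measurable N" for i
    using R unfolding D_def[abs_def] by measurable
  have D2: "integrable N (\<lambda>\<omega>. (D i \<omega>)\<^sup>2)" for i
    unfolding D_def power2_diff
    using R2[of i] square_integrable_imp_integrable[OF R R2, of i] by auto
  \<comment> \<open>Integrability of the products lets the expectation pass through the double sum;
    each product is dominated by the sum of the two squares.\<close>
  have DD: "integrable N (\<lambda>\<omega>. D i \<omega> * D j \<omega>)" for i j
  proof (rule Bochner_Integration.integrable_bound)
    show "integrable N (\<lambda>\<omega>. (D i \<omega>)\<^sup>2 + (D j \<omega>)\<^sup>2)"
      using D2 by simp
    show "(\<lambda>\<omega>. D i \<omega> * D j \<omega>) \<in> borel_measurable N"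
      using D by measurable
    show "AE \<omega> in N. norm (D i \<omega> * D j \<omega>) \<le> norm ((D i \<omega>)\<^sup>2 + (D j \<omega>)\<^sup>2)"
    proof (rule AE_I2)
      fix \<omega>
      have "2 * (\<bar>D i \<omega>\<bar> * \<bar>D j \<omega>\<bar>) \<le> (D i \<omega>)\<^sup>2 + (D j \<omega>)\<^sup>2"
        using sum_squares_bound[of "\<bar>D i \<omega>\<bar>" "\<bar>D j \<omega>\<bar>"] by simp
      moreover have "0 \<le> \<bar>D i \<omega>\<bar> * \<bar>D j \<omega>\<bar>"
        by simp
      ultimately have "\<bar>D i \<omega> * D j \<omega>\<bar> \<le> (D i \<omega>)\<^sup>2 + (D j \<omega>)\<^sup>2"
        unfolding abs_mult by linarith
      then show "norm (D i \<omega> * D j \<omega>) \<le> norm ((D i \<omega>)\<^sup>2 + (D j \<omega>)\<^sup>2)"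
        by simp
    qed
  qed
  have "(\<Sum>i\<in>UNIV. \<Sum>j\<in>UNIV. covariance N (R i) (R j) * x i * x j)
      = expectation (\<lambda>\<omega>. \<Sum>i\<in>UNIV. \<Sum>j\<in>UNIV. D i \<omega> * D j \<omega> * x i * x j)"
    using DD by (simp add: covariance_def D_def[symmetric])
  also have "\<dots> = expectation (\<lambda>\<omega>. (\<Sum>i\<in>UNIV. x i * D i \<omega>)\<^sup>2)"
    by (simp add: power2_eq_square sum_product mult_ac)
  also have "\<dots> \<ge> 0"
    by simp
  finally show ?thesis .
qed

lemma is_SOCP_portfolio_problem:
  fixes \<Sigma> :: "real^'n^'n"
  assumes psd: "\<And>x. 0 \<le> (\<Sum>i\<in>UNIV. \<Sum>j\<in>UNIV. \<Sigma> $ i $ j * x $ i * x $ j)"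
    and C: "soc_constraint C"
  shows "is_SOCP (portfolio_problem \<Sigma> C)"
proof -
  \<comment> \<open>The factor 1/2 is absorbed into the matrix.\<close>
  have half: "x \<bullet> (((1/2) *\<^sub>R \<Sigma>) *v x) = 1/2 * (\<Sum>i\<in>UNIV. \<Sum>j\<in>UNIV. \<Sigma> $ i $ j * x $ i * x $ j)" for x
    by (simp add: inner_matrix_vector_mult sum_divide_distrib)
  have "convex_quadratic (\<lambda>x. 1/2 * (\<Sum>i\<in>UNIV. \<Sum>j\<in>UNIV. \<Sigma> $ i $ j * x $ i * x $ j))"
    unfolding half[symmetric] by (rule convex_quadraticI) (unfold half, simp add: psd)
  moreover have "linear_constraint (\<lambda>x::real^'n. (\<Sum>i\<in>UNIV. x $ i) = 1)"
    unfolding linear_constraint_def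
    by (intro disjI2 exI[of _ "\<chi> i. 1"] exI[of _ 1]) (simp add: inner_vec_def)
  moreover have "linear_constraint (\<lambda>x::real^'n. 0 \<le> x $ i)" for i
    unfolding linear_constraint_def
    by (intro disjI1 exI[of _ "axis i (- 1)"] exI[of _ 0]) (simp add: inner_axis')
  ultimately show ?thesis
    using C by (auto simp: is_SOCP_def portfolio_problem_def)
qed

text \<open>Taking \<Sigma> as the covariance matrix of square-integrable returns supplies its
  positive semidefiniteness. The SOCP claim is made for \<open>1/2 \<le> \<beta>\<close>: below
  that, \<open>erf_inv (1 - 2 * \<beta>)\<close> is positive and the norm stands on the wrong side
  for a cone constraint.\<close>

theorem theorem1:
  fixes N :: "'b measure" and R :: "'n::finite \<Rightarrow> 'b \<Rightarrow> real" and \<Sigma> :: "real^'n^'n"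
    and M :: "'a measure" and \<zeta> :: "'n \<Rightarrow> 'a \<Rightarrow> real"
    and \<mu>0 m s :: "real^'n" and \<mu> :: "'n \<Rightarrow> real^'n" and \<tau> \<beta> :: real
  assumes "prob_space N"
    and "\<And>i. R i \<in> borel_measurable N"
    and "\<And>i. integrable N (\<lambda>\<omega>. (R i \<omega>)\<^sup>2)"
    and "\<And>i j. \<Sigma> $ i $ j = covariance N (R i) (R j)"
    and "\<And>i j. i \<noteq> j \<Longrightarrow> \<mu> j $ i = 0"
    and "prob_space M"
    and "prob_space.indep_vars M (\<lambda>_. borel) \<zeta> UNIV"
    and "\<And>j. s $ j > 0"
    and "\<And>j. distributed M lborel (\<zeta> j) (normal_density (m $ j) (s $ j))"
    and "0 < \<beta>" and "\<beta> < 1"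
  defines "P \<equiv> portfolio_problem \<Sigma> (chance_constraint M \<zeta> \<mu>0 \<mu> \<tau> \<beta>)"
    and "Q \<equiv> portfolio_problem \<Sigma> (deterministic_constraint m s \<mu>0 \<mu> \<tau> \<beta>)"
  shows "(\<forall>x. chance_constraint M \<zeta> \<mu>0 \<mu> \<tau> \<beta> x \<longleftrightarrow> deterministic_constraint m s \<mu>0 \<mu> \<tau> \<beta> x)
    \<and> objective P = objective Q \<and> feasible P = feasible Q \<and> minimizers P = minimizers Q
    \<and> (1/2 \<le> \<beta> \<longrightarrow> is_SOCP Q)"
proof -
  interpret prob_space M by fact
  have "chance_constraint M \<zeta> \<mu>0 \<mu> \<tau> \<beta> x \<longleftrightarrow> deterministic_constraint m s \<mu>0 \<mu> \<tau> \<beta> x" for x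
    by (rule chance_constraint_iff_deterministic_constraint) fact+
  \<comment> \<open>Constraints are predicates, so pointwise equivalence makes the two problems
    equal, and with them their feasible sets and minimizers.\<close>
  moreover from this have "P = Q"
    unfolding P_def Q_def by presburger
  moreover have "is_SOCP Q" if "1/2 \<le> \<beta>"
    unfolding Q_def
  proof (rule is_SOCP_portfolio_problem)
    show "0 \<le> (\<Sum>i\<in>UNIV. \<Sum>j\<in>UNIV. \<Sigma> $ i $ j * x $ i * x $ j)" for x :: "real^'n"
      using covariance_quadratic_form_nonneg[OF assms(1-3)] by (simp add: assms(4))
    show "soc_constraint (deterministic_constraint m s \<mu>0 \<mu> \<tau> \<beta>)"
      using that \<open>\<beta> < 1\<close> by (rule soc_constraint_deterministic_constraint)
  qed
  ultimately show ?thesis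
    by simp
qed

end
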